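(* Let $\mathcal{P}$ be a weakly connected and simple collection of cells of $\mathbb{Z}^2$. Then the bipartite graph $G(\mathcal{P})$ associated to $\mathcal{P}$ is weakly chordal, that is, every cycle of $G(\mathcal{P})$ of length greater than $4$ has a chord.
   Context: Order $\mathbb{Z}^2$ componentwise. For $a=(i,j)\le b=(k,l)$ the interval $[a,b]$ is $\{(r,s)\in\mathbb{Z}^2: i\le r\le k,\ j\le s\le l\}$. A cell is an interval $C=[a,a+(1,1)]$; its vertex set $V(C)$ consists of its four points, and its edge set $E(C)$ consists of $\{a,a+(1,0)\}$, $\{a+(1,0),a+(1,1)\}$, $\{a+(0,1),a+(1,1)\}$, $\{a,a+(0,1)\}$. Collections of cells are non-empty and finite. For a collection $\mathcal{P}$ of cells, $V(\mathcal{P})=\bigcup_{C\in\mathcal{P}}V(C)$ and $E(\mathcal{P})=\bigcup_{C\in\mathcal{P}}E(C)$. $\mathcal{P}$ is weakly connected if for any two cells $C,D\in\mathcal{P}$ there are cells $C=C_1,\dots,C_m=D$ of $\mathcal{P}$ with $V(C_i)\cap V(C_{i+1})\ne\emptyset$ for $i=1,\dots,m-1$. A path of cells is a sequence $C_1,\dots,C_m$ of pairwise distinct cells of $\mathbb{Z}^2$ such that $C_i\cap C_{i+1}$ is a common edge of $C_i$ and $C_{i+1}$ for $i=1,\dots,m-1$. $\mathcal{P}$ is simple if any two cells of $\mathbb{Z}^2$ not in $\mathcal{P}$ are joined by a path of cells none of which is in $\mathcal{P}$. A horizontal edge interval of $\mathcal{P}$ is an interval $[(i,j),(k,j)]$ with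 $i<k$ such that $\{(\ell,j),(\ell+1,j)\}\in E(\mathcal{P})$ for all $\ell=i,\dots,k-1$; it is maximal if moreover $\{(i-1,j),(i,j)\}$ and $\{(k,j),(k+1,j)\}$ are not in $E(\mathcal{P})$. (Maximal) vertical edge intervals are defined similarly. Let $\{V_i\}_{i\in I}$ and $\{H_j\}_{j\in J}$ be the sets of maximal vertical, respectively maximal horizontal, edge intervals of $\mathcal{P}$. The bipartite graph $G(\mathcal{P})$ has vertex set $\{v_i\}_{i\in I}\sqcup\{h_j\}_{j\in J}$ (one vertex for each maximal edge interval), and $\{v_i,h_j\}$ is an edge if and only if $V_i$ and $H_j$ meet in a vertex of $\mathcal{P}$. A cycle of length $2r$ in $G(\mathcal{P})$ consists of distinct vertices $v_{i_1},h_{j_1},\dots,v_{i_r},h_{j_r}$ with $\{v_{i_k},h_{j_k}\}$ and $\{h_{j_k},v_{i_{k+1}}\}$ edges for all $k=1,\dots,r$, where $i_{r+1}=i_1$. *)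

theory Defs
  imports Main "HOL-Library.Product_Order" "HOL-Library.Product_Plus"
begin

text \<open>The order on points is the componentwise one of \<^theory>\<open>HOL-Library.Product_Order\<close>, so
  \<^term>\<open>{a..b}\<close> is the interval \<open>[a, b]\<close> of the grid. A cell is identified with the set of its
  four vertices.\<close>

type_synonym point = "int \<times> int"
type_synonym cell = "point set"

definition is_cell :: "cell \<Rightarrow> bool" where
  "is_cell C \<longleftrightarrow> (\<exists>a::point. C = {a..a + (1, 1)})"

definition cell_edges :: "cell \<Rightarrow> point set set" where
  "cell_edges C = {e. \<exists>a::point. C = {a..a + (1, 1)} \<and>
     e \<in> {{a, a + (1, 0)}, {a + (1, 0), a + (1, 1)}, {a + (0, 1), a + (1, 1)}, {a, a + (0, 1)}}}"

definition cell_collection :: "cell set \<Rightarrow> bool" where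
  "cell_collection P \<longleftrightarrow> finite P \<and> P \<noteq> {} \<and> (\<forall>C\<in>P. is_cell C)"

definition vertices :: "cell set \<Rightarrow> point set" where
  "vertices P = (\<Union>C\<in>P. C)"

definition edges :: "cell set \<Rightarrow> point set set" where
  "edges P = (\<Union>C\<in>P. cell_edges C)"

definition weakly_connected :: "cell set \<Rightarrow> bool" where
  "weakly_connected P \<longleftrightarrow> (\<forall>C\<in>P. \<forall>D\<in>P. \<exists>cs. cs \<noteq> [] \<and> hd cs = C \<and> last cs = D \<and> set cs \<subseteq> P \<and>
     (\<forall>i. Suc i < length cs \<longrightarrow> cs ! i \<inter> cs ! Suc i \<noteq> {}))"

definition cell_path :: "cell list \<Rightarrow> bool" where
  "cell_path cs \<longleftrightarrow> cs \<noteq> [] \<and> distinct cs \<and> (\<forall>C\<in>set cs. is_cell C) \<and>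
     (\<forall>i. Suc i < length cs \<longrightarrow>
        cs ! i \<inter> cs ! Suc i \<in> cell_edges (cs ! i) \<inter> cell_edges (cs ! Suc i))"

definition simple_collection :: "cell set \<Rightarrow> bool" where
  "simple_collection P \<longleftrightarrow> (\<forall>C D. is_cell C \<and> C \<notin> P \<and> is_cell D \<and> D \<notin> P \<longrightarrow>
     (\<exists>cs. cell_path cs \<and> hd cs = C \<and> last cs = D \<and> set cs \<inter> P = {}))"

text \<open>The intervals \<open>[(i, j), (k, j)]\<close> and \<open>[(j, i), (j, k)]\<close>, respectively.\<close>

definition horizontal_edge_interval :: "cell set \<Rightarrow> int \<Rightarrow> int \<Rightarrow> int \<Rightarrow> bool" where
  "horizontal_edge_interval P j i k \<longleftrightarrow> i < k \<and> (\<forall>l\<in>{i..k - 1}. {(l, j), (l + 1, j)} \<in> edges P)"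

definition vertical_edge_interval :: "cell set \<Rightarrow> int \<Rightarrow> int \<Rightarrow> int \<Rightarrow> bool" where
  "vertical_edge_interval P j i k \<longleftrightarrow> i < k \<and> (\<forall>l\<in>{i..k - 1}. {(j, l), (j, l + 1)} \<in> edges P)"

definition maximal_horizontal :: "cell set \<Rightarrow> point set set" where
  "maximal_horizontal P = {{(i, j)..(k, j)} | i j k. horizontal_edge_interval P j i k \<and>
     {(i - 1, j), (i, j)} \<notin> edges P \<and> {(k, j), (k + 1, j)} \<notin> edges P}"

definition maximal_vertical :: "cell set \<Rightarrow> point set set" where
  "maximal_vertical P = {{(j, i)..(j, k)} | i j k. vertical_edge_interval P j i k \<and>
     {(j, i - 1), (j, i)} \<notin> edges P \<and> {(j, k), (j, k + 1)} \<notin> edges P}"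

text \<open>A bipartite graph is a pair of a vertex set and a set of two-element edges; the two sides of
  the bipartition are the summands of the vertex type.\<close>

type_synonym ('a, 'b) bigraph = "('a + 'b) set \<times> ('a + 'b) set set"

definition interval_graph :: "cell set \<Rightarrow> (point set, point set) bigraph" where
  "interval_graph P =
     (maximal_vertical P <+> maximal_horizontal P,
      {{Inl V, Inr H} | V H. V \<in> maximal_vertical P \<and> H \<in> maximal_horizontal P \<and>
         V \<inter> H \<inter> vertices P \<noteq> {}})"

text \<open>The lists \<open>[v\<^sub>1, \<dots>, v\<^sub>r]\<close> and \<open>[h\<^sub>1, \<dots>, h\<^sub>r]\<close> describe the cycle
  \<open>v\<^sub>1, h\<^sub>1, \<dots>, v\<^sub>r, h\<^sub>r\<close> of length \<open>2 r\<close>.\<close>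

definition cycle_vertices :: "'a list \<Rightarrow> 'b list \<Rightarrow> ('a + 'b) set" where
  "cycle_vertices vs hs = set vs <+> set hs"

definition cycle_edges :: "'a list \<Rightarrow> 'b list \<Rightarrow> ('a + 'b) set set" where
  "cycle_edges vs hs =
     {{Inl (vs ! k), Inr (hs ! k)} | k. k < length vs} \<union>
     {{Inr (hs ! k), Inl (vs ! (Suc k mod length vs))} | k. k < length vs}"

definition is_cycle :: "('a, 'b) bigraph \<Rightarrow> 'a list \<Rightarrow> 'b list \<Rightarrow> bool" where
  "is_cycle G vs hs \<longleftrightarrow> length vs = length hs \<and> length vs \<ge> 2 \<and> distinct vs \<and> distinct hs \<and>
     cycle_vertices vs hs \<subseteq> fst G \<and> cycle_edges vs hs \<subseteq> snd G"

definition has_chord :: "('a, 'b) bigraph \<Rightarrow> 'a list \<Rightarrow> 'b list \<Rightarrow> bool" where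
  "has_chord G vs hs \<longleftrightarrow> (\<exists>e\<in>snd G. e \<subseteq> cycle_vertices vs hs \<and> e \<notin> cycle_edges vs hs)"

definition weakly_chordal :: "('a, 'b) bigraph \<Rightarrow> bool" where
  "weakly_chordal G \<longleftrightarrow> (\<forall>vs hs. is_cycle G vs hs \<and> length vs + length hs > 4 \<longrightarrow> has_chord G vs hs)"

end

theory Submission imports Defs begin

text \<open>A cycle of the interval graph traces a closed rectilinear polygon along edges of \<open>P\<close>: its
  vertical sides lie in the intervals \<open>V\<^sub>k\<close>, its horizontal sides in the intervals \<open>H\<^sub>k\<close>. The
  winding number of this polygon around (the centre of) a cell changes only when an edge lying in
  some \<open>V\<^sub>k\<close> or \<open>H\<^sub>k\<close> is crossed. Such an edge belongs to a cell of \<open>P\<close>, so the winding number is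
  constant on paths of cells outside \<open>P\<close>; since \<open>P\<close> is finite and simple, it vanishes outside \<open>P\<close>
  (\<open>winding_zero_outside\<close>). It is not identically zero, because the intervals of the cycle are
  distinct, hence different vertical sides have no unit edge in common and crossing one of them
  changes the winding number.

  Thus the cells with nonzero winding number form a finite nonempty set \<open>S\<close> of cells of \<open>P\<close>. Choose
  a rectangle in \<open>S\<close> that is maximal under inclusion. Beyond each of its four sides there is a cell
  outside \<open>S\<close>, so each side contains a unit edge that lies in an interval of the cycle. All edges of
  the rectangle belong to \<open>P\<close>, so by maximality this interval contains the whole side. The two
  vertical and two horizontal intervals obtained meet pairwise at the corners of the rectangle. But a
  cycle of length greater than four does not contain a 4-cycle, so one of these four incidences is a
  chord (\<open>four_cycle_gives_chord\<close>).\<close>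

section \<open>Winding numbers of closed rectilinear polygons\<close>

text \<open>The polygon has the corners \<open>(X k, Y k)\<close> and \<open>(X (k + 1), Y k)\<close>, with indices modulo \<open>r\<close>. The sum
  counts, with signs, the horizontal sides met by the ray going down from the centre of the cell
  with lower left corner \<open>(x, y)\<close>.\<close>

definition winding :: "(nat \<Rightarrow> int) \<Rightarrow> (nat \<Rightarrow> int) \<Rightarrow> nat \<Rightarrow> int \<Rightarrow> int \<Rightarrow> int" where
  "winding X Y r x y =
     (\<Sum>k<r. of_bool (Y k \<le> y) * (of_bool (x < X k) - of_bool (x < X (Suc k mod r))))"

lemma bij_betw_cyclic_Suc: "bij_betw (\<lambda>k. Suc k mod r) {..<r} {..<r}"
proof (cases "r = 0")
  case False
  have "inj_on (\<lambda>k. Suc k mod r) {..<r}"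
    by (rule inj_onI) (auto simp: mod_Suc split: if_splits)
  then show ?thesis
    using False by (simp add: bij_betw_def endo_inj_surj image_subset_iff)
qed (simp add: bij_betw_def)

text \<open>Summation by parts around the cycle: the ray going down may be replaced by the ray going to
  the right, which meets vertical sides instead.\<close>

lemma winding_by_vertical_sides:
  "winding X Y r x y =
     (\<Sum>k<r. of_bool (x < X (Suc k mod r)) * (of_bool (Y (Suc k mod r) \<le> y) - of_bool (Y k \<le> y)))"
proof -
  have "(\<Sum>k<r. of_bool (Y (Suc k mod r) \<le> y) * of_bool (x < X (Suc k mod r)))
      = (\<Sum>k<r. of_bool (Y k \<le> y) * (of_bool (x < X k) :: int))"
    by (rule sum.reindex_bij_betw[OF bij_betw_cyclic_Suc])
  then show ?thesis
    by (simp add: winding_def right_diff_distrib sum_subtractf mult.commute)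
qed

lemma winding_eq_0_if_right_of:
  assumes "\<And>k. k < r \<Longrightarrow> X k \<le> x"
  shows "winding X Y r x y = 0"
proof -
  have "of_bool (x < X k) = (0::int)" if "k < r" for k
    using assms[OF that] by simp
  then show ?thesis
    unfolding winding_by_vertical_sides by (intro sum.neutral) auto
qed

lemma winding_changes_vertically:
  assumes "winding X Y r x y \<noteq> winding X Y r x (y - 1)"
  shows "\<exists>k<r. Y k = y \<and> min (X k) (X (Suc k mod r)) \<le> x \<and> x < max (X k) (X (Suc k mod r))"
proof (rule ccontr)
  assume contra: "\<not> ?thesis"
  have "winding X Y r x y = winding X Y r x (y - 1)"
    unfolding winding_def
  proof (rule sum.cong[OF refl])
    fix k assume "k \<in> {..<r}"
    then have "Y k \<noteq> y \<or> (x < X k \<longleftrightarrow> x < X (Suc k mod r))"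
      using contra by fastforce
    then show "of_bool (Y k \<le> y) * (of_bool (x < X k) - of_bool (x < X (Suc k mod r)))
        = of_bool (Y k \<le> y - 1) * (of_bool (x < X k) - (of_bool (x < X (Suc k mod r)) :: int))"
      by (auto simp: of_bool_def)
  qed
  with assms show False by contradiction
qed

lemma winding_changes_horizontally:
  assumes "winding X Y r x y \<noteq> winding X Y r (x - 1) y"
  shows "\<exists>k<r. X (Suc k mod r) = x \<and>
    min (Y k) (Y (Suc k mod r)) \<le> y \<and> y < max (Y k) (Y (Suc k mod r))"
proof (rule ccontr)
  assume contra: "\<not> ?thesis"
  have "winding X Y r x y = winding X Y r (x - 1) y"
    unfolding winding_by_vertical_sides
  proof (rule sum.cong[OF refl])
    fix k assume "k \<in> {..<r}"
    then have "X (Suc k mod r) \<noteq> x \<or> (Y (Suc k mod r) \<le> y \<longleftrightarrow> Y k \<le> y)"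
      using contra by fastforce
    then show "of_bool (x < X (Suc k mod r)) * (of_bool (Y (Suc k mod r) \<le> y) - of_bool (Y k \<le> y))
        = of_bool (x - 1 < X (Suc k mod r)) *
            (of_bool (Y (Suc k mod r) \<le> y) - (of_bool (Y k \<le> y) :: int))"
      by (auto simp: of_bool_def)
  qed
  with assms show False by contradiction
qed

text \<open>A side whose unit edge is covered by no other vertical side contributes \<open>1\<close> or \<open>-1\<close> to the
  difference of the winding numbers to its left and to its right.\<close>

lemma winding_changes_across_uncovered_edge:
  assumes k: "k < r" "X (Suc k mod r) = x"
    and y: "min (Y k) (Y (Suc k mod r)) \<le> y" "y < max (Y k) (Y (Suc k mod r))"
    and unique: "\<And>l. \<lbrakk>l < r; X (Suc l mod r) = x;
      min (Y l) (Y (Suc l mod r)) \<le> y; y < max (Y l) (Y (Suc l mod r))\<rbrakk> \<Longrightarrow> l = k"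
  shows "winding X Y r x y \<noteq> winding X Y r (x - 1) y"
proof -
  let ?d = "\<lambda>l. of_bool (Y (Suc l mod r) \<le> y) - (of_bool (Y l \<le> y) :: int)"
  have "winding X Y r (x - 1) y - winding X Y r x y
      = (\<Sum>l<r. of_bool (X (Suc l mod r) = x) * ?d l)"
    unfolding winding_by_vertical_sides sum_subtractf[symmetric]
    by (rule sum.cong[OF refl]) (auto simp: of_bool_def)
  also have "\<dots> = (\<Sum>l<r. if l = k then ?d k else 0)"
  proof (rule sum.cong[OF refl])
    fix l assume "l \<in> {..<r}"
    then have "l = k \<or> X (Suc l mod r) \<noteq> x \<or> (Y (Suc l mod r) \<le> y \<longleftrightarrow> Y l \<le> y)"
      using unique[of l] by fastforce
    then show "of_bool (X (Suc l mod r) = x) * ?d l = (if l = k then ?d k else 0)"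
      using k(2) by (auto simp: of_bool_def)
  qed
  also have "\<dots> = ?d k"
    using k(1) by simp
  also have "\<dots> \<noteq> 0"
    using y by (auto simp: of_bool_def min_def max_def split: if_splits)
  finally show ?thesis by simp
qed

section \<open>Maximal rectangles\<close>

lemma maximal_rectangle:
  fixes S :: "(int \<times> int) set"
  assumes "finite S" "S \<noteq> {}"
  obtains x1 x2 y1 y2 where "x1 < x2" "y1 < y2" "{x1..<x2} \<times> {y1..<y2} \<subseteq> S"
    "\<exists>y\<in>{y1..<y2}. (x1 - 1, y) \<notin> S" "\<exists>y\<in>{y1..<y2}. (x2, y) \<notin> S"
    "\<exists>x\<in>{x1..<x2}. (x, y1 - 1) \<notin> S" "\<exists>x\<in>{x1..<x2}. (x, y2) \<notin> S"
proof -
  define F where "F = {R. R \<subseteq> S \<and> (\<exists>x1 x2 y1 y2. x1 < x2 \<and> y1 < y2 \<and> R = {x1..<x2} \<times> {y1..<y2})}"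
  have "finite F"
    by (rule finite_subset[of _ "Pow S"]) (auto simp: F_def assms)
  moreover have "F \<noteq> {}"
  proof -
    obtain x y where "(x, y) \<in> S" using assms(2) by auto
    moreover have "{x..<x + 1} \<times> {y..<y + 1} = {(x, y)}" by auto
    ultimately have "{x..<x + 1} \<times> {y..<y + 1} \<subseteq> S" by simp
    moreover have "x < x + 1" "y < y + 1" by simp_all
    ultimately have "{x..<x + 1} \<times> {y..<y + 1} \<in> F" unfolding F_def by blast
    then show ?thesis by blast
  qed
  ultimately obtain R where R: "R \<in> F" and max: "\<And>R'. R' \<in> F \<Longrightarrow> R \<subseteq> R' \<Longrightarrow> R' = R"
    using finite_has_maximal[of F] by metis
  from R obtain x1 x2 y1 y2 where less: "x1 < x2" "y1 < y2"
    and R_eq: "R = {x1..<x2} \<times> {y1..<y2}" and sub: "R \<subseteq> S"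
    unfolding F_def by blast
  have not_sub: "\<not> {a..<b} \<times> {c..<d} \<subseteq> S"
    if "a \<le> x1" "x2 \<le> b" "c \<le> y1" "y2 \<le> d" "(a, b, c, d) \<noteq> (x1, x2, y1, y2)" for a b c d
  proof
    assume "{a..<b} \<times> {c..<d} \<subseteq> S"
    moreover have "a < b" "c < d" using that less by linarith+
    ultimately have "{a..<b} \<times> {c..<d} \<in> F" unfolding F_def by blast
    moreover have "R \<subseteq> {a..<b} \<times> {c..<d}" using that R_eq by auto
    ultimately have "{a..<b} \<times> {c..<d} = {x1..<x2} \<times> {y1..<y2}" using max R_eq by blast
    then show False
      using that(5) less \<open>a < b\<close> \<open>c < d\<close> by (auto simp: times_eq_iff atLeastLessThan_eq_iff)
  qed
  show thesis
  proof
    show "x1 < x2" "y1 < y2" "{x1..<x2} \<times> {y1..<y2} \<subseteq> S" using less sub R_eq by auto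
    show "\<exists>y\<in>{y1..<y2}. (x1 - 1, y) \<notin> S"
    proof (rule ccontr)
      assume "\<not> ?thesis"
      then have "{x1 - 1} \<times> {y1..<y2} \<subseteq> S" by blast
      moreover have "{x1 - 1..<x2} \<times> {y1..<y2} \<subseteq> R \<union> {x1 - 1} \<times> {y1..<y2}"
        using R_eq by auto
      ultimately have "{x1 - 1..<x2} \<times> {y1..<y2} \<subseteq> S" using sub by blast
      then show False using not_sub[of "x1 - 1" x2 y1 y2] by simp
    qed
    show "\<exists>y\<in>{y1..<y2}. (x2, y) \<notin> S"
    proof (rule ccontr)
      assume "\<not> ?thesis"
      then have "{x2} \<times> {y1..<y2} \<subseteq> S" by blast
      moreover have "{x1..<x2 + 1} \<times> {y1..<y2} \<subseteq> R \<union> {x2} \<times> {y1..<y2}"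
        using R_eq by auto
      ultimately have "{x1..<x2 + 1} \<times> {y1..<y2} \<subseteq> S" using sub by blast
      then show False using not_sub[of x1 "x2 + 1" y1 y2] by simp
    qed
    show "\<exists>x\<in>{x1..<x2}. (x, y1 - 1) \<notin> S"
    proof (rule ccontr)
      assume "\<not> ?thesis"
      then have "{x1..<x2} \<times> {y1 - 1} \<subseteq> S" by blast
      moreover have "{x1..<x2} \<times> {y1 - 1..<y2} \<subseteq> R \<union> {x1..<x2} \<times> {y1 - 1}"
        using R_eq by auto
      ultimately have "{x1..<x2} \<times> {y1 - 1..<y2} \<subseteq> S" using sub by blast
      then show False using not_sub[of x1 x2 "y1 - 1" y2] by simp
    qed
    show "\<exists>x\<in>{x1..<x2}. (x, y2) \<notin> S"
    proof (rule ccontr)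
      assume "\<not> ?thesis"
      then have "{x1..<x2} \<times> {y2} \<subseteq> S" by blast
      moreover have "{x1..<x2} \<times> {y1..<y2 + 1} \<subseteq> R \<union> {x1..<x2} \<times> {y2}"
        using R_eq by auto
      ultimately have "{x1..<x2} \<times> {y1..<y2 + 1} \<subseteq> S" using sub by blast
      then show False using not_sub[of x1 x2 y1 "y2 + 1"] by simp
    qed
  qed
qed

section \<open>Cells and edges in coordinates\<close>

definition cell_at :: "int \<Rightarrow> int \<Rightarrow> cell" where
  "cell_at x y = {(x, y)..(x, y) + (1, 1)}"

lemma cell_at_eq_iff [simp]: "cell_at x y = cell_at x' y' \<longleftrightarrow> x = x' \<and> y = y'"
  by (auto simp: cell_at_def Icc_eq_Icc)

lemma mem_cell_at: "(u, v) \<in> cell_at x y \<longleftrightarrow> u \<in> {x, x + 1} \<and> v \<in> {y, y + 1}"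
  by (auto simp: cell_at_def)

lemma is_cell_iff: "is_cell C \<longleftrightarrow> (\<exists>x y. C = cell_at x y)"
  by (auto simp: is_cell_def cell_at_def)

lemma cell_edges_cell_at:
  "cell_edges (cell_at x y) =
     {{(x, y), (x + 1, y)}, {(x + 1, y), (x + 1, y + 1)}, {(x, y + 1), (x + 1, y + 1)},
      {(x, y), (x, y + 1)}}"
proof -
  have "cell_at x y = {a..a + (1, 1)} \<longleftrightarrow> a = (x, y)" for a
    unfolding cell_at_def by (cases a) (auto simp: Icc_eq_Icc)
  then show ?thesis
    unfolding cell_edges_def by auto
qed

lemma vertical_edge_iff:
  assumes "\<forall>C\<in>P. is_cell C"
  shows "{(x, y), (x, y + 1)} \<in> edges P \<longleftrightarrow> cell_at (x - 1) y \<in> P \<or> cell_at x y \<in> P"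
proof
  assume "{(x, y), (x, y + 1)} \<in> edges P"
  then obtain C where C: "C \<in> P" "{(x, y), (x, y + 1)} \<in> cell_edges C"
    unfolding edges_def by blast
  moreover obtain u v where "C = cell_at u v"
    using assms C(1) unfolding is_cell_iff by blast
  ultimately show "cell_at (x - 1) y \<in> P \<or> cell_at x y \<in> P"
    by (auto simp: cell_edges_cell_at doubleton_eq_iff)
next
  have "{(x, y), (x, y + 1)} \<in> cell_edges (cell_at (x - 1) y)"
    "{(x, y), (x, y + 1)} \<in> cell_edges (cell_at x y)"
    by (simp_all add: cell_edges_cell_at)
  then show "cell_at (x - 1) y \<in> P \<or> cell_at x y \<in> P \<Longrightarrow> {(x, y), (x, y + 1)} \<in> edges P"
    unfolding edges_def by blast
qed

lemma horizontal_edge_iff: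
  assumes "\<forall>C\<in>P. is_cell C"
  shows "{(x, y), (x + 1, y)} \<in> edges P \<longleftrightarrow> cell_at x (y - 1) \<in> P \<or> cell_at x y \<in> P"
proof
  assume "{(x, y), (x + 1, y)} \<in> edges P"
  then obtain C where C: "C \<in> P" "{(x, y), (x + 1, y)} \<in> cell_edges C"
    unfolding edges_def by blast
  moreover obtain u v where "C = cell_at u v"
    using assms C(1) unfolding is_cell_iff by blast
  ultimately show "cell_at x (y - 1) \<in> P \<or> cell_at x y \<in> P"
    by (auto simp: cell_edges_cell_at doubleton_eq_iff)
next
  have "{(x, y), (x + 1, y)} \<in> cell_edges (cell_at x (y - 1))"
    "{(x, y), (x + 1, y)} \<in> cell_edges (cell_at x y)"
    by (simp_all add: cell_edges_cell_at)
  then show "cell_at x (y - 1) \<in> P \<or> cell_at x y \<in> P \<Longrightarrow> {(x, y), (x + 1, y)} \<in> edges P"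
    unfolding edges_def by blast
qed

lemma cells_with_common_edge:
  assumes "e \<in> cell_edges (cell_at x y)" "e \<in> cell_edges (cell_at u v)"
    and "cell_at x y \<noteq> cell_at u v"
  shows "v = y \<and> (u = x + 1 \<or> x = u + 1) \<or> u = x \<and> (v = y + 1 \<or> y = v + 1)"
proof -
  have "x \<noteq> u \<or> y \<noteq> v" using assms(3) by simp
  then show ?thesis
    using assms(1,2) unfolding cell_edges_cell_at insert_iff empty_iff
    by (elim disjE FalseE) (auto simp: doubleton_eq_iff)
qed

section \<open>Maximal edge intervals\<close>

text \<open>Maximal edge intervals in both directions are maximal runs of a predicate on the unit
  intervals \<open>[l, l + 1]\<close> of a line.\<close>

definition maximal_run :: "(int \<Rightarrow> bool) \<Rightarrow> int \<Rightarrow> int \<Rightarrow> bool" where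
  "maximal_run e i k \<longleftrightarrow> i < k \<and> (\<forall>l\<in>{i..k - 1}. e l) \<and> \<not> e (i - 1) \<and> \<not> e k"

lemma maximal_run_covers:
  assumes run: "maximal_run e i k" and e: "\<forall>l\<in>{a..<b}. e l"
    and p: "p \<in> {i..<k}" "p \<in> {a..<b}"
  shows "i \<le> a \<and> b \<le> k"
proof (rule ccontr)
  assume "\<not> ?thesis"
  then have "i - 1 \<in> {a..<b} \<or> k \<in> {a..<b}" using p by auto
  then show False using run e unfolding maximal_run_def by blast
qed

lemma maximal_run_unique:
  assumes "maximal_run e i k" "maximal_run e i' k'" "p \<in> {i..k}" "p \<in> {i'..k'}"
  shows "i = i' \<and> k = k'"
proof -
  have e: "e l" if "l \<in> {i..k - 1} \<or> l \<in> {i'..k' - 1}" for l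
    using that assms(1,2) unfolding maximal_run_def by blast
  have ends: "\<not> e (i - 1)" "\<not> e k" "\<not> e (i' - 1)" "\<not> e k'"
    using assms(1,2) unfolding maximal_run_def by auto
  have "\<not> i < i'" using e[of "i' - 1"] ends assms(3,4) by auto
  moreover have "\<not> i' < i" using e[of "i - 1"] ends assms(3,4) by auto
  moreover have "\<not> k < k'" using e[of k] ends assms(3,4) by auto
  moreover have "\<not> k' < k" using e[of k'] ends assms(3,4) by auto
  ultimately show ?thesis by auto
qed

lemma maximal_vertical_runE:
  assumes "V \<in> maximal_vertical P"
  obtains j i k where "\<And>x y. (x, y) \<in> V \<longleftrightarrow> x = j \<and> y \<in> {i..k}"
    "maximal_run (\<lambda>l. {(j, l), (j, l + 1)} \<in> edges P) i k" "V = {(j, i)..(j, k)}"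
proof -
  from assms obtain i j k where V: "V = {(j, i)..(j, k)}" "vertical_edge_interval P j i k"
    "{(j, i - 1), (j, i)} \<notin> edges P" "{(j, k), (j, k + 1)} \<notin> edges P"
    unfolding maximal_vertical_def by blast
  show thesis
  proof
    show "maximal_run (\<lambda>l. {(j, l), (j, l + 1)} \<in> edges P) i k"
      using V(2-4) by (auto simp: maximal_run_def vertical_edge_interval_def)
  qed (auto simp: V(1))
qed

lemma maximal_horizontal_runE:
  assumes "H \<in> maximal_horizontal P"
  obtains j i k where "\<And>x y. (x, y) \<in> H \<longleftrightarrow> y = j \<and> x \<in> {i..k}"
    "maximal_run (\<lambda>l. {(l, j), (l + 1, j)} \<in> edges P) i k" "H = {(i, j)..(k, j)}"
proof -
  from assms obtain i j k where H: "H = {(i, j)..(k, j)}" "horizontal_edge_interval P j i k"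
    "{(i - 1, j), (i, j)} \<notin> edges P" "{(k, j), (k + 1, j)} \<notin> edges P"
    unfolding maximal_horizontal_def by blast
  show thesis
  proof
    show "maximal_run (\<lambda>l. {(l, j), (l + 1, j)} \<in> edges P) i k"
      using H(2-4) by (auto simp: maximal_run_def horizontal_edge_interval_def)
  qed (auto simp: H(1))
qed

lemma maximal_vertical_disjoint:
  assumes "V \<in> maximal_vertical P" "V' \<in> maximal_vertical P" "(x, y) \<in> V" "(x, y) \<in> V'"
  shows "V = V'"
  using assms(1)
proof (rule maximal_vertical_runE)
  fix j i k assume V: "\<And>x y. (x, y) \<in> V \<longleftrightarrow> x = j \<and> y \<in> {i..k}"
    "maximal_run (\<lambda>l. {(j, l), (j, l + 1)} \<in> edges P) i k" "V = {(j, i)..(j, k)}"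
  from assms(2) show ?thesis
  proof (rule maximal_vertical_runE)
    fix j' i' k' assume V': "\<And>x y. (x, y) \<in> V' \<longleftrightarrow> x = j' \<and> y \<in> {i'..k'}"
      "maximal_run (\<lambda>l. {(j', l), (j', l + 1)} \<in> edges P) i' k'" "V' = {(j', i')..(j', k')}"
    have "j' = j" "y \<in> {i..k}" "y \<in> {i'..k'}" using assms(3,4) V(1) V'(1) by auto
    then show ?thesis using maximal_run_unique V(2,3) V'(2,3) by blast
  qed
qed

lemma maximal_horizontal_disjoint:
  assumes "H \<in> maximal_horizontal P" "H' \<in> maximal_horizontal P" "(x, y) \<in> H" "(x, y) \<in> H'"
  shows "H = H'"
  using assms(1)
proof (rule maximal_horizontal_runE)
  fix j i k assume H: "\<And>x y. (x, y) \<in> H \<longleftrightarrow> y = j \<and> x \<in> {i..k}"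
    "maximal_run (\<lambda>l. {(l, j), (l + 1, j)} \<in> edges P) i k" "H = {(i, j)..(k, j)}"
  from assms(2) show ?thesis
  proof (rule maximal_horizontal_runE)
    fix j' i' k' assume H': "\<And>x y. (x, y) \<in> H' \<longleftrightarrow> y = j' \<and> x \<in> {i'..k'}"
      "maximal_run (\<lambda>l. {(l, j'), (l + 1, j')} \<in> edges P) i' k'" "H' = {(i', j')..(k', j')}"
    have "j' = j" "x \<in> {i..k}" "x \<in> {i'..k'}" using assms(3,4) H(1) H'(1) by auto
    then show ?thesis using maximal_run_unique H(2,3) H'(2,3) by blast
  qed
qed

lemma maximal_vertical_covers:
  assumes V: "V \<in> maximal_vertical P" "(x, y) \<in> V" "(x, y + 1) \<in> V"
    and edges: "\<And>l. a \<le> l \<Longrightarrow> l < b \<Longrightarrow> {(x, l), (x, l + 1)} \<in> edges P"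
    and y: "a \<le> y" "y < b"
  shows "(x, a) \<in> V" "(x, b) \<in> V"
proof -
  from V(1) have "(x, a) \<in> V \<and> (x, b) \<in> V"
  proof (rule maximal_vertical_runE)
    fix j i k assume V': "\<And>x y. (x, y) \<in> V \<longleftrightarrow> x = j \<and> y \<in> {i..k}"
      "maximal_run (\<lambda>l. {(j, l), (j, l + 1)} \<in> edges P) i k"
    have "i \<le> a \<and> b \<le> k"
      using maximal_run_covers[OF V'(2), of a b y] edges y V(2,3) V'(1) by simp
    then show ?thesis using V(2,3) V'(1) y by auto
  qed
  then show "(x, a) \<in> V" "(x, b) \<in> V" by auto
qed

lemma maximal_horizontal_covers:
  assumes H: "H \<in> maximal_horizontal P" "(x, y) \<in> H" "(x + 1, y) \<in> H"
    and edges: "\<And>l. a \<le> l \<Longrightarrow> l < b \<Longrightarrow> {(l, y), (l + 1, y)} \<in> edges P"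
    and x: "a \<le> x" "x < b"
  shows "(a, y) \<in> H" "(b, y) \<in> H"
proof -
  from H(1) have "(a, y) \<in> H \<and> (b, y) \<in> H"
  proof (rule maximal_horizontal_runE)
    fix j i k assume H': "\<And>x y. (x, y) \<in> H \<longleftrightarrow> y = j \<and> x \<in> {i..k}"
      "maximal_run (\<lambda>l. {(l, j), (l + 1, j)} \<in> edges P) i k"
    have "i \<le> a \<and> b \<le> k"
      using maximal_run_covers[OF H'(2), of a b x] edges x H(2,3) H'(1) by simp
    then show ?thesis using H(2,3) H'(1) x by auto
  qed
  then show "(a, y) \<in> H" "(b, y) \<in> H" by auto
qed

lemma maximal_vertical_same_column:
  assumes "V \<in> maximal_vertical P" "(x, y) \<in> V" "(x', y') \<in> V"
  shows "x = x'"
  using assms(1) by (rule maximal_vertical_runE) (use assms(2,3) in auto)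

lemma maximal_horizontal_same_row:
  assumes "H \<in> maximal_horizontal P" "(x, y) \<in> H" "(x', y') \<in> H"
  shows "y = y'"
  using assms(1) by (rule maximal_horizontal_runE) (use assms(2,3) in auto)

lemma maximal_vertical_between:
  assumes "V \<in> maximal_vertical P" "(x, a) \<in> V" "(x, b) \<in> V" "min a b \<le> y" "y < max a b"
  shows "(x, y) \<in> V" "(x, y + 1) \<in> V" "{(x, y), (x, y + 1)} \<in> edges P"
proof -
  from assms(1) have "(x, y) \<in> V \<and> (x, y + 1) \<in> V \<and> {(x, y), (x, y + 1)} \<in> edges P"
  proof (rule maximal_vertical_runE)
    fix j i k assume V: "\<And>x y. (x, y) \<in> V \<longleftrightarrow> x = j \<and> y \<in> {i..k}"
      "maximal_run (\<lambda>l. {(j, l), (j, l + 1)} \<in> edges P) i k"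
    then have "x = j" "y \<in> {i..k - 1}" using assms(2-5) by auto
    then show ?thesis using V unfolding maximal_run_def by auto
  qed
  then show "(x, y) \<in> V" "(x, y + 1) \<in> V" "{(x, y), (x, y + 1)} \<in> edges P" by auto
qed

lemma maximal_horizontal_between:
  assumes "H \<in> maximal_horizontal P" "(a, y) \<in> H" "(b, y) \<in> H" "min a b \<le> x" "x < max a b"
  shows "(x, y) \<in> H" "(x + 1, y) \<in> H" "{(x, y), (x + 1, y)} \<in> edges P"
proof -
  from assms(1) have "(x, y) \<in> H \<and> (x + 1, y) \<in> H \<and> {(x, y), (x + 1, y)} \<in> edges P"
  proof (rule maximal_horizontal_runE)
    fix j i k assume H: "\<And>x y. (x, y) \<in> H \<longleftrightarrow> y = j \<and> x \<in> {i..k}"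
      "maximal_run (\<lambda>l. {(l, j), (l + 1, j)} \<in> edges P) i k"
    then have "y = j" "x \<in> {i..k - 1}" using assms(2-5) by auto
    then show ?thesis using H unfolding maximal_run_def by auto
  qed
  then show "(x, y) \<in> H" "(x + 1, y) \<in> H" "{(x, y), (x + 1, y)} \<in> edges P" by auto
qed

section \<open>The collection contains the cells with nonzero winding number\<close>

text \<open>A path of cells outside \<open>P\<close> crosses no edge of \<open>P\<close>. As \<open>P\<close> is finite and simple, such a path
  leads from any cell outside \<open>P\<close> to a cell to the right of the whole polygon.\<close>

lemma winding_zero_outside:
  assumes P: "cell_collection P" "simple_collection P"
    and vertical: "\<And>x y. winding X Y r x y \<noteq> winding X Y r (x - 1) y \<Longrightarrow>
      {(x, y), (x, y + 1)} \<in> edges P"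
    and horizontal: "\<And>x y. winding X Y r x y \<noteq> winding X Y r x (y - 1) \<Longrightarrow>
      {(x, y), (x + 1, y)} \<in> edges P"
    and outside: "cell_at x y \<notin> P"
  shows "winding X Y r x y = 0"
proof -
  have cells: "\<forall>C\<in>P. is_cell C" and "finite P"
    using P(1) by (auto simp: cell_collection_def)
  \<comment> \<open>\<open>0\<close> keeps the set nonempty when \<open>r = 0\<close>\<close>
  define far where "far = Max (X ` {..<r} \<union> {0})"
  have far: "X k \<le> far" if "k < r" for k
    unfolding far_def using that by (intro Max_ge) auto
  have "finite ((\<lambda>u. cell_at u y) -` P)"
    using \<open>finite P\<close> by (rule finite_vimageI) (simp add: inj_on_def)
  then have "\<not> {far..} \<subseteq> (\<lambda>u. cell_at u y) -` P"
    using infinite_Ici finite_subset by blast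
  then obtain u where u: "far \<le> u" "cell_at u y \<notin> P"
    by auto
  have far_zero: "winding X Y r u y = 0"
    using far u(1) by (intro winding_eq_0_if_right_of) force
  obtain cs where path: "cell_path cs" and ends: "hd cs = cell_at x y" "last cs = cell_at u y"
    and avoid: "set cs \<inter> P = {}"
    using P(2) outside u(2) unfolding simple_collection_def is_cell_iff by metis
  have cs: "cs \<noteq> []" "distinct cs" "\<forall>C\<in>set cs. is_cell C"
    "\<And>i. Suc i < length cs \<Longrightarrow>
      cs ! i \<inter> cs ! Suc i \<in> cell_edges (cs ! i) \<inter> cell_edges (cs ! Suc i)"
    using path unfolding cell_path_def by auto
  have step_right: "winding X Y r (a + 1) b = winding X Y r a b"
    if "cell_at a b \<notin> P" "cell_at (a + 1) b \<notin> P" for a b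
    using vertical[of "a + 1" b] vertical_edge_iff[OF cells, of "a + 1" b] that by fastforce
  have step_up: "winding X Y r a (b + 1) = winding X Y r a b"
    if "cell_at a b \<notin> P" "cell_at a (b + 1) \<notin> P" for a b
    using horizontal[of a "b + 1"] horizontal_edge_iff[OF cells, of a "b + 1"] that by fastforce
  have "winding X Y r a b = winding X Y r x y"
    if "i < length cs" "cs ! i = cell_at a b" for i a b
    using that
  proof (induction i arbitrary: a b)
    case 0
    then show ?case using ends(1) cs(1) by (simp add: hd_conv_nth)
  next
    case (Suc i)
    obtain c d where cd: "cs ! i = cell_at c d"
      using cs(3) Suc.prems(1) unfolding is_cell_iff by (meson Suc_lessD nth_mem)
    have "cell_at c d \<noteq> cell_at a b"
      using cs(2) Suc.prems cd by (metis Suc_lessD n_not_Suc_n nth_eq_iff_index_eq)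
    then have adj: "b = d \<and> (a = c + 1 \<or> c = a + 1) \<or> a = c \<and> (b = d + 1 \<or> d = b + 1)"
      using cells_with_common_edge cs(4)[OF Suc.prems(1)] Suc.prems(2) cd by (metis IntD1 IntD2)
    have "cell_at a b \<notin> P" "cell_at c d \<notin> P"
      using avoid Suc.prems cd by (metis Suc_lessD disjoint_iff nth_mem)+
    then have "winding X Y r a b = winding X Y r c d"
      using adj by (elim disjE conjE; metis step_right step_up)
    then show ?case using Suc.IH[OF _ cd] Suc.prems(1) by simp
  qed
  from this[of "length cs - 1" u y] show ?thesis
    using far_zero ends(2) cs(1) by (simp add: last_conv_nth)
qed

section \<open>Chords of cycles\<close>

lemma is_cycle_interval_graphD:
  assumes "is_cycle (interval_graph P) vs hs" "k < length vs"
  shows "vs ! k \<in> maximal_vertical P" "hs ! k \<in> maximal_horizontal P"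
    "vs ! k \<inter> hs ! k \<noteq> {}" "vs ! (Suc k mod length vs) \<inter> hs ! k \<noteq> {}"
proof -
  have len: "length hs = length vs" and sub: "cycle_edges vs hs \<subseteq> snd (interval_graph P)"
    and verts: "cycle_vertices vs hs \<subseteq> fst (interval_graph P)"
    using assms(1) by (auto simp: is_cycle_def)
  have "Inl (vs ! k) \<in> cycle_vertices vs hs" "Inr (hs ! k) \<in> cycle_vertices vs hs"
    using assms(2) len by (auto simp: cycle_vertices_def)
  then show "vs ! k \<in> maximal_vertical P" "hs ! k \<in> maximal_horizontal P"
    using verts by (auto simp: interval_graph_def)
  have "{Inl (vs ! k), Inr (hs ! k)} \<in> snd (interval_graph P)"
    "{Inr (hs ! k), Inl (vs ! (Suc k mod length vs))} \<in> snd (interval_graph P)"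
    using sub assms(2) unfolding cycle_edges_def by blast+
  then show "vs ! k \<inter> hs ! k \<noteq> {}" "vs ! (Suc k mod length vs) \<inter> hs ! k \<noteq> {}"
    by (auto simp: interval_graph_def doubleton_eq_iff)
qed

text \<open>If none of the four edges is a chord, then \<open>m\<close> and \<open>n\<close> both have \<open>i\<close> and \<open>j\<close> as their two
  neighbours on the cycle, which therefore closes up after four steps.\<close>

lemma four_cycle_gives_chord:
  assumes cycle: "is_cycle G vs hs" and r: "length vs \<ge> 3"
    and less: "i < length vs" "j < length vs" "m < length vs" "n < length vs"
    and neq: "i \<noteq> j" "m \<noteq> n"
    and adjacent: "\<And>v h. v \<in> {i, j} \<Longrightarrow> h \<in> {m, n} \<Longrightarrow> {Inl (vs ! v), Inr (hs ! h)} \<in> snd G"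
  shows "has_chord G vs hs"
proof (rule ccontr)
  assume no_chord: "\<not> has_chord G vs hs"
  have cyc: "length hs = length vs" "distinct vs" "distinct hs"
    using cycle by (auto simp: is_cycle_def)
  have pos: "v = h \<or> v = Suc h mod length vs" if vh: "v \<in> {i, j}" "h \<in> {m, n}" for v h
  proof -
    have bounds: "v < length vs" "h < length vs" using vh less by auto
    have "{Inl (vs ! v), Inr (hs ! h)} \<subseteq> cycle_vertices vs hs"
      using bounds cyc(1) by (auto simp: cycle_vertices_def)
    then have "{Inl (vs ! v), Inr (hs ! h)} \<in> cycle_edges vs hs"
      using no_chord adjacent[OF vh] unfolding has_chord_def by blast
    then obtain k where k: "k < length vs" "hs ! h = hs ! k"
      "vs ! v = vs ! k \<or> vs ! v = vs ! (Suc k mod length vs)"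
      by (auto simp: cycle_edges_def doubleton_eq_iff)
    have "Suc k mod length vs < length vs"
      by (rule mod_less_divisor) (use k(1) in linarith)
    then have "v = k \<or> v = Suc k mod length vs"
      using k(1,3) bounds cyc(2) by (auto simp: nth_eq_iff_index_eq)
    moreover have "h = k" using k(1,2) bounds cyc by (simp add: nth_eq_iff_index_eq)
    ultimately show ?thesis by simp
  qed
  have "Suc m mod length vs = n" "Suc n mod length vs = m"
    using pos[of i m] pos[of i n] pos[of j m] pos[of j n] neq by auto
  then show False
    using r less neq by (auto simp: mod_Suc split: if_splits)
qed

section \<open>Weak chordality\<close>

theorem proposition3p2:
  fixes P :: "cell set"
  assumes "cell_collection P" and "weakly_connected P" and "simple_collection P"
  shows "weakly_chordal (interval_graph P)"
  unfolding weakly_chordal_def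
proof (intro allI impI)
  fix vs hs
  assume "is_cycle (interval_graph P) vs hs \<and> length vs + length hs > 4"
  then have cycle: "is_cycle (interval_graph P) vs hs" and long: "length vs + length hs > 4"
    by auto
  define r where "r = length vs"
  have r: "r \<ge> 3" and len: "length vs = r" "length hs = r" and dist: "distinct vs" "distinct hs"
    using cycle long by (auto simp: is_cycle_def r_def)
  have cells: "\<forall>C\<in>P. is_cell C" and "finite P"
    using assms(1) by (auto simp: cell_collection_def)
  have succ_less: "Suc k mod r < r" for k using r by simp
  have mv: "vs ! k \<in> maximal_vertical P" and mh: "hs ! k \<in> maximal_horizontal P"
    and meet: "vs ! k \<inter> hs ! k \<noteq> {}" and meet_Suc: "vs ! (Suc k mod r) \<inter> hs ! k \<noteq> {}"
    if "k < r" for k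
    using is_cycle_interval_graphD[OF cycle] that by (simp_all add: r_def)

  define p where "p = (\<lambda>k. SOME q. q \<in> vs ! k \<inter> hs ! k)"
  define X where "X k = fst (p k)" for k
  define Y where "Y k = snd (p k)" for k
  have corner: "(X k, Y k) \<in> vs ! k" "(X k, Y k) \<in> hs ! k" if "k < r" for k
    using someI_ex[of "\<lambda>q. q \<in> vs ! k \<inter> hs ! k"] meet[OF that]
    by (auto simp: p_def X_def Y_def)
  have corner_Suc: "(X (Suc k mod r), Y k) \<in> vs ! (Suc k mod r)" "(X (Suc k mod r), Y k) \<in> hs ! k"
    if k: "k < r" for k
  proof -
    obtain u v where uv: "(u, v) \<in> vs ! (Suc k mod r)" "(u, v) \<in> hs ! k"
      using meet_Suc[OF k] by auto
    have "u = X (Suc k mod r)"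
      using maximal_vertical_same_column[OF mv[OF succ_less] uv(1) corner(1)[OF succ_less]] .
    moreover have "v = Y k"
      using maximal_horizontal_same_row[OF mh[OF k] uv(2) corner(2)[OF k]] .
    ultimately show "(X (Suc k mod r), Y k) \<in> vs ! (Suc k mod r)" "(X (Suc k mod r), Y k) \<in> hs ! k"
      using uv by auto
  qed

  have vertical: "\<exists>i<r. (x, y) \<in> vs ! i \<and> (x, y + 1) \<in> vs ! i \<and> {(x, y), (x, y + 1)} \<in> edges P"
    if change: "winding X Y r x y \<noteq> winding X Y r (x - 1) y" for x y
  proof -
    obtain k where k: "k < r" "X (Suc k mod r) = x"
      "min (Y k) (Y (Suc k mod r)) \<le> y" "y < max (Y k) (Y (Suc k mod r))"
      using winding_changes_horizontally[OF change] by blast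
    show ?thesis
      using maximal_vertical_between[OF mv[OF succ_less] corner_Suc(1)[OF k(1)]
          corner(1)[OF succ_less] k(3,4)] k(2) succ_less by blast
  qed
  have horizontal: "\<exists>i<r. (x, y) \<in> hs ! i \<and> (x + 1, y) \<in> hs ! i \<and> {(x, y), (x + 1, y)} \<in> edges P"
    if change: "winding X Y r x y \<noteq> winding X Y r x (y - 1)" for x y
  proof -
    obtain k where k: "k < r" "Y k = y"
      "min (X k) (X (Suc k mod r)) \<le> x" "x < max (X k) (X (Suc k mod r))"
      using winding_changes_vertically[OF change] by blast
    show ?thesis
      using maximal_horizontal_between[OF mh[OF k(1)] corner(2)[OF k(1)] corner_Suc(2)[OF k(1)]
          k(3,4)] k(1,2) by blast
  qed

  define S where "S = {(x, y). winding X Y r x y \<noteq> 0}"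
  have S_P: "cell_at x y \<in> P" if "(x, y) \<in> S" for x y
    using winding_zero_outside[OF assms(1,3), of X Y r x y] vertical horizontal that
    unfolding S_def by blast
  have "finite S"
  proof (rule finite_subset)
    show "S \<subseteq> (\<lambda>(x, y). cell_at x y) -` P" using S_P by auto
    show "finite ((\<lambda>(x, y). cell_at x y) -` P)"
      using \<open>finite P\<close> by (rule finite_vimageI) (auto simp: inj_on_def)
  qed
  moreover have "S \<noteq> {}"
  proof -
    have "Y 0 \<noteq> Y (Suc 0 mod r)"
    proof
      \<comment> \<open>otherwise two horizontal intervals of the cycle share the corner \<open>(X 1, Y 1)\<close>\<close>
      assume eq: "Y 0 = Y (Suc 0 mod r)"
      have "hs ! 0 = hs ! 1"
        using maximal_horizontal_disjoint[OF mh mh corner_Suc(2)[of 0], of 1] corner(2)[of 1] eq r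
        by simp
      then show False using dist(2) len r by (simp add: nth_eq_iff_index_eq)
    qed
    then obtain y where y: "min (Y 0) (Y (Suc 0 mod r)) \<le> y" "y < max (Y 0) (Y (Suc 0 mod r))"
      by (metis linorder_neqE_linordered_idom max_def min_def order.refl order.strict_implies_order
          not_le)
    have on: "(X (Suc l mod r), y) \<in> vs ! (Suc l mod r)"
      if "l < r" "min (Y l) (Y (Suc l mod r)) \<le> y" "y < max (Y l) (Y (Suc l mod r))" for l
      using maximal_vertical_between(1)[OF mv[OF succ_less] corner_Suc(1)[OF that(1)]
          corner(1)[OF succ_less] that(2,3)] .
    \<comment> \<open>a second side through this edge would lie in the same interval of the cycle\<close>
    have "winding X Y r (X (Suc 0 mod r)) y \<noteq> winding X Y r (X (Suc 0 mod r) - 1) y"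
    proof (rule winding_changes_across_uncovered_edge[OF _ refl y])
      show "0 < r" using r by simp
      fix l assume l: "l < r" "X (Suc l mod r) = X (Suc 0 mod r)"
        "min (Y l) (Y (Suc l mod r)) \<le> y" "y < max (Y l) (Y (Suc l mod r))"
      have "(X (Suc 0 mod r), y) \<in> vs ! (Suc l mod r)" using on[OF l(1,3,4)] l(2) by simp
      moreover have "(X (Suc 0 mod r), y) \<in> vs ! (Suc 0 mod r)" using on[OF _ y] r by simp
      ultimately have "vs ! (Suc l mod r) = vs ! (Suc 0 mod r)"
        by (rule maximal_vertical_disjoint[OF mv[OF succ_less] mv[OF succ_less]])
      then have "Suc l mod r = Suc 0 mod r"
        using nth_eq_iff_index_eq[OF dist(1)] len(1) succ_less by blast
      then show "l = 0"
        by (rule inj_onD[OF bij_betw_imp_inj_on[OF bij_betw_cyclic_Suc]]) (use l(1) r in auto)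
    qed
    then have "winding X Y r (X (Suc 0 mod r)) y \<noteq> 0 \<or>
        winding X Y r (X (Suc 0 mod r) - 1) y \<noteq> 0"
      by auto
    then show ?thesis unfolding S_def by blast
  qed
  ultimately obtain x1 x2 y1 y2 where less: "x1 < x2" "y1 < y2"
    and R: "{x1..<x2} \<times> {y1..<y2} \<subseteq> S"
    and left: "\<exists>y\<in>{y1..<y2}. (x1 - 1, y) \<notin> S" and right: "\<exists>y\<in>{y1..<y2}. (x2, y) \<notin> S"
    and bottom: "\<exists>x\<in>{x1..<x2}. (x, y1 - 1) \<notin> S" and top: "\<exists>x\<in>{x1..<x2}. (x, y2) \<notin> S"
    by (rule maximal_rectangle)
  have in_R: "(x, y) \<in> S" if "x1 \<le> x" "x < x2" "y1 \<le> y" "y < y2" for x y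
    by (rule subsetD[OF R]) (use that in simp)
  have R_P: "cell_at x y \<in> P" if "x1 \<le> x" "x < x2" "y1 \<le> y" "y < y2" for x y
    using S_P[OF in_R] that by blast

  \<comment> \<open>The winding number changes across an edge between \<open>S\<close> and its complement, so this edge lies in
    an interval of the cycle, which extends over the whole side of the rectangle by maximality.\<close>
  have vertical_side: "\<exists>i<r. (x, y1) \<in> vs ! i \<and> (x, y2) \<in> vs ! i"
    if x: "x = x1 \<or> x = x2" and y: "y1 \<le> y" "y < y2" "((x - 1, y) \<in> S) \<noteq> ((x, y) \<in> S)" for x y
  proof -
    have "winding X Y r x y \<noteq> winding X Y r (x - 1) y" using y(3) by (auto simp: S_def)
    then obtain i where i: "i < r" "(x, y) \<in> vs ! i" "(x, y + 1) \<in> vs ! i"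
      using vertical by blast
    have "{(x, l), (x, l + 1)} \<in> edges P" if "y1 \<le> l" "l < y2" for l
      using x that less R_P[of x l] R_P[of "x - 1" l] by (auto simp: vertical_edge_iff[OF cells])
    then show ?thesis using maximal_vertical_covers[OF mv[OF i(1)] i(2,3) _ y(1,2)] i(1) by blast
  qed
  have horizontal_side: "\<exists>i<r. (x1, y) \<in> hs ! i \<and> (x2, y) \<in> hs ! i"
    if y: "y = y1 \<or> y = y2" and x: "x1 \<le> x" "x < x2" "((x, y - 1) \<in> S) \<noteq> ((x, y) \<in> S)" for x y
  proof -
    have "winding X Y r x y \<noteq> winding X Y r x (y - 1)" using x(3) by (auto simp: S_def)
    then obtain i where i: "i < r" "(x, y) \<in> hs ! i" "(x + 1, y) \<in> hs ! i"
      using horizontal by blast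
    have "{(l, y), (l + 1, y)} \<in> edges P" if "x1 \<le> l" "l < x2" for l
      using y that less R_P[of l y] R_P[of l "y - 1"] by (auto simp: horizontal_edge_iff[OF cells])
    then show ?thesis using maximal_horizontal_covers[OF mh[OF i(1)] i(2,3) _ x(1,2)] i(1) by blast
  qed
  obtain i where i: "i < r" "(x1, y1) \<in> vs ! i" "(x1, y2) \<in> vs ! i"
    using left vertical_side[of x1] in_R[of x1] less by fastforce
  obtain j where j: "j < r" "(x2, y1) \<in> vs ! j" "(x2, y2) \<in> vs ! j"
    using right vertical_side[of x2] in_R[of "x2 - 1"] less by fastforce
  obtain m where m: "m < r" "(x1, y1) \<in> hs ! m" "(x2, y1) \<in> hs ! m"
    using bottom horizontal_side[of y1] in_R[of _ y1] less by fastforce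
  obtain n where n: "n < r" "(x1, y2) \<in> hs ! n" "(x2, y2) \<in> hs ! n"
    using top horizontal_side[of y2] in_R[of _ "y2 - 1"] less by fastforce

  have adjacent: "{Inl (vs ! a), Inr (hs ! b)} \<in> snd (interval_graph P)"
    if "a < r" "b < r" "q \<in> vs ! a" "q \<in> hs ! b" "q \<in> vertices P" for a b q
    using that mv[of a] mh[of b] unfolding interval_graph_def by auto
  have vertex: "(u, v) \<in> vertices P"
    if "x1 \<le> x" "x < x2" "y1 \<le> y" "y < y2" "u \<in> {x, x + 1}" "v \<in> {y, y + 1}" for u v x y
    using R_P[OF that(1-4)] that(5,6) unfolding vertices_def by (blast intro: mem_cell_at[THEN iffD2])
  have corners: "(x1, y1) \<in> vertices P" "(x1, y2) \<in> vertices P"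
    "(x2, y1) \<in> vertices P" "(x2, y2) \<in> vertices P"
    by (rule vertex[of x1 y1] vertex[of x1 "y2 - 1"] vertex[of "x2 - 1" y1]
        vertex[of "x2 - 1" "y2 - 1"]; use less in simp)+
  show "has_chord (interval_graph P) vs hs"
  proof (rule four_cycle_gives_chord[OF cycle])
    show "length vs \<ge> 3" "i < length vs" "j < length vs" "m < length vs" "n < length vs"
      using r len i j m n by auto
    show "i \<noteq> j"
      using maximal_vertical_same_column[OF mv[OF i(1)] i(2)] j(2) less by blast
    show "m \<noteq> n"
      using maximal_horizontal_same_row[OF mh[OF m(1)] m(2)] n(2) less by blast
    show "{Inl (vs ! v), Inr (hs ! h)} \<in> snd (interval_graph P)" if "v \<in> {i, j}" "h \<in> {m, n}" for v h
      using that i j m n corners adjacent by auto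
  qed
qed

end
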